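(* Let $1<\beta\le2$. For each $M$ let $N=N(M)$ be chosen depending on $M$ in such a way that there is $\nu\in\mathbb R$ with $\nu_\beta\le\nu$ for all $M$. Then for any $\varepsilon>0$ there exist $M^*>0$ and $N^*>0$ such that, for any $M>M^*$, $$R^{-1}A-I=\hat U_M+\hat V_M,$$ where $\hat U_M,\hat V_M$ are matrices of order $M-1$ with $\operatorname{rank}(\hat U_M)\le N^*$ and $\|\hat V_M\|_2<\varepsilon$.
   Context: Fixed data: $K,L,T>0$, a positive integer $J$, and a weight function $\omega:[1,2]\to\mathbb R$ with $\omega(\alpha)\ge0$ and $\omega(\alpha)\neq0$ for $\alpha\in[1,2]$, $0<\int_1^2\omega(\alpha)\,d\alpha<\infty$. For integers $M\ge2$, $N\ge1$: $h=L/M$, $\tau=T/N$, $\nu_\beta=\frac{\tau}{2h^\beta}$; $\Delta\alpha=\frac1{2J}$, $\alpha_l=1+l\Delta\alpha$, $\gamma_l=\alpha_l-1$ ($0\le l\le2J$), $c_0=c_{2J}=\frac12$, $c_l=1$ for $1\le l\le2J-1$; $\lambda_0^{(\gamma)}=1+\frac\gamma2$; $\mu_0=\Delta\alpha\sum_{l=0}^{2J}c_l\,\omega(\alpha_l)\tau^{-\gamma_l}\lambda_0^{(\gamma_l)}$. $\hat g_k^{(\beta)}=\dfrac{(-1)^k\Gamma(\beta+1)}{\Gamma(\beta/2-k+1)\Gamma(\beta/2+k+1)}$ for $k\in\mathbb Z$ (with $1/\Gamma(z)=0$ at non-positive integers $z$). $G_\beta$ is the Toeplitz matrix of order $M-1$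 with $(i,j)$ entry $\hat g_{i-j}^{(\beta)}$. $r(G_\beta)$ (R. Chan's circulant approximation) is the circulant matrix of order $n=M-1$ with $(i,j)$ entry $r_{i-j}$, where $r_0=\hat g_0^{(\beta)}$, $r_k=\hat g_k^{(\beta)}+\hat g_{k-n}^{(\beta)}$ for $0<k<n$, and $r_k=r_{k+n}$ for $0<-k<n$. $A=\mu_0I+K\nu_\beta G_\beta$ and $R=\mu_0I+K\nu_\beta\, r(G_\beta)$, with $I$ the identity of order $M-1$. All of $A,R,G_\beta,\mu_0,\nu_\beta$ depend on $M$ (with $N=N(M)$). $\|\cdot\|_2$ is the spectral norm. *)

theory Defs
  imports "HOL-Analysis.Analysis" "Jordan_Normal_Form.DL_Rank"
    "Jordan_Normal_Form.Gauss_Jordan_Elimination"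
begin

text \<open>
  The order \<open>M - 1\<close> of the matrices varies inside the theorem, so they have the carrier-based type
  \<open>real mat\<close> of Jordan_Normal_Form.  Its indices start at 0, which does not change an \<open>(i,j)\<close>
  entry that depends on \<open>i - j\<close> only.
\<close>

definition toeplitz_mat :: "nat \<Rightarrow> (int \<Rightarrow> real) \<Rightarrow> real mat" where
  "toeplitz_mat n t = Matrix.mat n n (\<lambda>(i, j). t (int i - int j))"

text \<open>The operator norm induced by the Euclidean vector norm.\<close>

definition spectral_norm :: "real mat \<Rightarrow> real" where
  "spectral_norm B =
     (SUP v \<in> {v \<in> carrier_vec (dim_col B). sqrt (scalar_prod v v) \<le> 1}.
        sqrt (scalar_prod (B *\<^sub>v v) (B *\<^sub>v v)))"

text \<open>\<open>rGamma\<close> is \<open>1 / Gamma\<close>, with value 0 at the non-positive integers.\<close>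

definition g_hat :: "real \<Rightarrow> int \<Rightarrow> real" where
  "g_hat \<beta> k = (-1) powi k * Gamma (\<beta> + 1)
     * rGamma (\<beta> / 2 - of_int k + 1) * rGamma (\<beta> / 2 + of_int k + 1)"

definition G_mat :: "real \<Rightarrow> nat \<Rightarrow> real mat" where
  "G_mat \<beta> M = toeplitz_mat (M - 1) (g_hat \<beta>)"

text \<open>R. Chan's circulant approximation; only the values at \<open>\<bar>k\<bar> < n\<close> are used.\<close>

definition chan_coeff :: "nat \<Rightarrow> (int \<Rightarrow> real) \<Rightarrow> int \<Rightarrow> real" where
  "chan_coeff n t k =
     (let r = (\<lambda>k. t k + t (k - int n))
      in if k = 0 then t 0 else if 0 < k then r k else r (k + int n))"

definition rG_mat :: "real \<Rightarrow> nat \<Rightarrow> real mat" where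
  "rG_mat \<beta> M = toeplitz_mat (M - 1) (chan_coeff (M - 1) (g_hat \<beta>))"

definition nu :: "real \<Rightarrow> real \<Rightarrow> real \<Rightarrow> nat \<Rightarrow> nat \<Rightarrow> real" where
  "nu L T \<beta> M N = (T / real N) / (2 * (L / real M) powr \<beta>)"

definition lambda0 :: "real \<Rightarrow> real" where
  "lambda0 \<gamma> = 1 + \<gamma> / 2"

definition mu0 :: "real \<Rightarrow> nat \<Rightarrow> (real \<Rightarrow> real) \<Rightarrow> nat \<Rightarrow> real" where
  "mu0 T J \<omega> N =
     (let \<tau> = T / real N;
          \<Delta>\<alpha> = 1 / (2 * real J);
          \<alpha> = (\<lambda>l::nat. 1 + real l * \<Delta>\<alpha>);
          \<gamma> = (\<lambda>l. \<alpha> l - 1);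
          c = (\<lambda>l. if l = 0 \<or> l = 2 * J then 1 / 2 else 1)
      in \<Delta>\<alpha> * (\<Sum>l = 0..2 * J. c l * \<omega> (\<alpha> l) * \<tau> powr (- \<gamma> l) * lambda0 (\<gamma> l)))"

definition A_mat :: "real \<Rightarrow> real \<Rightarrow> real \<Rightarrow> nat \<Rightarrow> (real \<Rightarrow> real) \<Rightarrow> real \<Rightarrow> nat \<Rightarrow> nat \<Rightarrow> real mat" where
  "A_mat K L T J \<omega> \<beta> M N =
     mu0 T J \<omega> N \<cdot>\<^sub>m 1\<^sub>m (M - 1) + (K * nu L T \<beta> M N) \<cdot>\<^sub>m G_mat \<beta> M"

definition R_mat :: "real \<Rightarrow> real \<Rightarrow> real \<Rightarrow> nat \<Rightarrow> (real \<Rightarrow> real) \<Rightarrow> real \<Rightarrow> nat \<Rightarrow> nat \<Rightarrow> real mat" where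
  "R_mat K L T J \<omega> \<beta> M N =
     mu0 T J \<omega> N \<cdot>\<^sub>m 1\<^sub>m (M - 1) + (K * nu L T \<beta> M N) \<cdot>\<^sub>m rG_mat \<beta> M"

end

theory Submission
  imports Defs
begin

text \<open>
  Write \<open>t k\<close> for the symbol \<open>g_hat \<beta> k\<close>, \<open>n\<close> for the order \<open>M - 1\<close>, \<open>\<mu> = mu0\<close> and
  \<open>\<kappa> = K * nu\<close>.  Since \<open>t\<close> is even, the difference of the Toeplitz matrix and its circulant
  approximation has the entries \<open>- t (n - \<bar>i - j\<bar>)\<close> off the diagonal and 0 on it: it is large only
  in the two corners away from the diagonal.  Cutting at \<open>\<bar>i - j\<bar> > n - p\<close> gives a corner part
  whose nonzero columns number at most \<open>2 * p\<close>, and a band part whose absolute row and column sums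
  are at most twice a tail of \<open>\<Sum>k. \<bar>t k\<bar>\<close>.  The Schur test turns the latter into a small spectral
  norm.  As \<open>R\<inverse> A - I = \<kappa> R\<inverse> (corner + band)\<close>, a bound on the inverse of \<open>R\<close> that is
  uniform in \<open>n\<close> is all that is left to find.

  Both the convergence of the series and the bound on the inverse come from one property of the
  symbol: \<open>t k \<le> 0\<close> for \<open>k \<noteq> 0\<close>, while the two-sided partial sums of \<open>t\<close> are nonnegative.  Hence
  \<open>2 * (\<Sum>k\<ge>1. \<bar>t k\<bar>) \<le> t 0\<close>, and the circulant matrix is symmetric and weakly diagonally dominant,
  since each of its rows collects every \<open>t k\<close> with \<open>0 < \<bar>k\<bar> < n\<close> exactly once.  It is therefore
  positive semidefinite (\<open>chan_quadratic_form_nonneg\<close>), and \<open>R\<close> is bounded below by \<open>\<mu>\<close>.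
  These two steps give \<open>chan_preconditioner_clustering\<close> for every symbol of this kind.

  For \<open>g_hat\<close> the partial sums have a closed form, because the two-term recurrence of the
  coefficients makes the sum telescope (\<open>g_hat_partial_sum\<close>).  Finally \<open>\<mu>\<close> stays away from 0 as
  \<open>M\<close> grows: its term for \<open>l = 0\<close> carries the factor \<open>\<tau> powr 0 = 1\<close> and does not depend on \<open>\<tau>\<close>
  (\<open>mu0_ge\<close>), and \<open>\<kappa>\<close> is bounded by hypothesis.
\<close>

(* The bullet and the dollar sign denote the operations on carrier-based vectors below, not those
   of inner product spaces and of vectors indexed by a finite type. *)
unbundle no inner_syntax and no vec_syntax

section \<open>Scalar products, the Schur test and the spectral norm\<close>

lemma scalar_prod_nonpos_imp_zero:
  fixes x :: "real Matrix.vec"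
  assumes "x \<in> carrier_vec n" "x \<bullet> x \<le> 0"
  shows "x = 0\<^sub>v n"
proof -
  have "(\<Sum>i = 0..<n. x $ i * x $ i) \<le> 0"
    using assms by (auto simp: scalar_prod_def)
  moreover have "(\<Sum>i = 0..<n. x $ i * x $ i) \<ge> 0"
    by (intro sum_nonneg) auto
  ultimately have "(\<Sum>i = 0..<n. x $ i * x $ i) = 0" by linarith
  then have "\<forall>i\<in>{0..<n}. x $ i * x $ i = 0"
    by (subst (asm) sum_nonneg_eq_0_iff) auto
  then show ?thesis using assms by (intro eq_vecI) auto
qed

lemma scalar_prod_young:
  fixes x y :: "real Matrix.vec"
  assumes "x \<in> carrier_vec n" "y \<in> carrier_vec n" "s > 0"
  shows "2 * (y \<bullet> x) \<le> s * (y \<bullet> y) + (x \<bullet> x) / s"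
proof -
  have "2 * (a * b) \<le> s * (a * a) + (b * b) / s" for a b :: real
  proof -
    have "0 \<le> (s * a - b)\<^sup>2 / s" using assms(3) by simp
    also have "\<dots> = s * (a * a) + (b * b) / s - 2 * (a * b)"
      using assms(3) by (simp add: power2_eq_square field_simps)
    finally show ?thesis by simp
  qed
  then have "(\<Sum>i = 0..<n. 2 * (y $ i * x $ i))
      \<le> (\<Sum>i = 0..<n. s * (y $ i * y $ i) + (x $ i * x $ i) / s)"
    by (intro sum_mono)
  then show ?thesis using assms
    by (simp add: scalar_prod_def sum_distrib_left sum_divide_distrib sum.distrib)
qed

lemma smult_mat_mult_vec:
  fixes A :: "'a :: comm_semiring_0 mat"
  assumes "A \<in> carrier_mat n m" "x \<in> carrier_vec m"
  shows "(a \<cdot>\<^sub>m A) *\<^sub>v x = a \<cdot>\<^sub>v (A *\<^sub>v x)"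
  using assms by (intro eq_vecI) (auto simp: scalar_prod_def sum_distrib_left ac_simps intro!: sum.cong)

lemma quadratic_form_shift:
  fixes A :: "real mat"
  assumes A: "A \<in> carrier_mat n n" and x: "x \<in> carrier_vec n"
  shows "x \<bullet> ((a \<cdot>\<^sub>m 1\<^sub>m n + b \<cdot>\<^sub>m A) *\<^sub>v x) = a * (x \<bullet> x) + b * (x \<bullet> (A *\<^sub>v x))"
proof -
  have "(a \<cdot>\<^sub>m 1\<^sub>m n + b \<cdot>\<^sub>m A) *\<^sub>v x = a \<cdot>\<^sub>v x + b \<cdot>\<^sub>v (A *\<^sub>v x)"
    using A x by (simp add: add_mult_distrib_mat_vec[of _ n n] smult_mat_mult_vec[of _ n n])
  then show ?thesis using A x
    by (simp add: scalar_prod_add_distrib[of _ n] mult_mat_vec_carrier[of _ n n])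
qed

text \<open>
  Young's inequality \<open>2 * \<bar>a * b\<bar> \<le> a\<^sup>2 + b\<^sup>2\<close> applied entry by entry charges each \<open>\<bar>B $$ (i, j)\<bar>\<close>
  once to \<open>y $ i\<close> and once to \<open>x $ j\<close>.  With \<open>y = x\<close> this is Gershgorin's bound for the quadratic
  form; with \<open>y\<close> a multiple of \<open>B *\<^sub>v x\<close> it is the Schur test.
\<close>

lemma schur_test_bilinear:
  fixes B :: "real mat"
  assumes B: "B \<in> carrier_mat n n"
    and row: "\<And>i. i < n \<Longrightarrow> (\<Sum>j = 0..<n. \<bar>B $$ (i, j)\<bar>) \<le> C"
    and col: "\<And>j. j < n \<Longrightarrow> (\<Sum>i = 0..<n. \<bar>B $$ (i, j)\<bar>) \<le> C"
    and x: "x \<in> carrier_vec n" and y: "y \<in> carrier_vec n"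
  shows "2 * \<bar>y \<bullet> (B *\<^sub>v x)\<bar> \<le> C * (y \<bullet> y + x \<bullet> x)"
proof -
  have "y \<bullet> (B *\<^sub>v x) = (\<Sum>i = 0..<n. \<Sum>j = 0..<n. y $ i * (B $$ (i, j) * x $ j))"
    using B x y by (auto simp: scalar_prod_def sum_distrib_left intro!: sum.cong)
  then have "2 * \<bar>y \<bullet> (B *\<^sub>v x)\<bar> \<le> 2 * (\<Sum>i = 0..<n. \<Sum>j = 0..<n. \<bar>y $ i * (B $$ (i, j) * x $ j)\<bar>)"
    by (simp add: sum_abs[THEN order_trans] sum_mono)
  also have "\<dots> \<le> (\<Sum>i = 0..<n. \<Sum>j = 0..<n. \<bar>B $$ (i, j)\<bar> * (y $ i)\<^sup>2 + \<bar>B $$ (i, j)\<bar> * (x $ j)\<^sup>2)"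
    unfolding sum_distrib_left
  proof (intro sum_mono)
    fix i j
    have "2 * (\<bar>y $ i\<bar> * \<bar>x $ j\<bar>) \<le> (y $ i)\<^sup>2 + (x $ j)\<^sup>2"
      using sum_squares_bound[of "\<bar>y $ i\<bar>" "\<bar>x $ j\<bar>"] by simp
    from mult_left_mono[OF this, of "\<bar>B $$ (i, j)\<bar>"]
    show "2 * \<bar>y $ i * (B $$ (i, j) * x $ j)\<bar> \<le> \<bar>B $$ (i, j)\<bar> * (y $ i)\<^sup>2 + \<bar>B $$ (i, j)\<bar> * (x $ j)\<^sup>2"
      by (simp add: abs_mult algebra_simps)
  qed
  also have "\<dots> = (\<Sum>i = 0..<n. (\<Sum>j = 0..<n. \<bar>B $$ (i, j)\<bar>) * (y $ i)\<^sup>2)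
      + (\<Sum>j = 0..<n. (\<Sum>i = 0..<n. \<bar>B $$ (i, j)\<bar>) * (x $ j)\<^sup>2)"
  proof -
    have "(\<Sum>i = 0..<n. \<Sum>j = 0..<n. \<bar>B $$ (i, j)\<bar> * (x $ j)\<^sup>2)
        = (\<Sum>j = 0..<n. \<Sum>i = 0..<n. \<bar>B $$ (i, j)\<bar> * (x $ j)\<^sup>2)"
      by (rule sum.swap)
    then show ?thesis by (simp add: sum.distrib sum_distrib_right)
  qed
  also have "\<dots> \<le> (\<Sum>i = 0..<n. C * (y $ i)\<^sup>2) + (\<Sum>j = 0..<n. C * (x $ j)\<^sup>2)"
    using row col by (intro add_mono sum_mono mult_right_mono) auto
  also have "\<dots> = C * (y \<bullet> y + x \<bullet> x)"
    using x y by (simp add: scalar_prod_def sum_distrib_left power2_eq_square distrib_left)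
  finally show ?thesis .
qed

lemma schur_test:
  fixes B :: "real mat"
  assumes B: "B \<in> carrier_mat n n"
    and row: "\<And>i. i < n \<Longrightarrow> (\<Sum>j = 0..<n. \<bar>B $$ (i, j)\<bar>) \<le> C"
    and col: "\<And>j. j < n \<Longrightarrow> (\<Sum>i = 0..<n. \<bar>B $$ (i, j)\<bar>) \<le> C"
    and C: "C > 0" and x: "x \<in> carrier_vec n"
  shows "(B *\<^sub>v x) \<bullet> (B *\<^sub>v x) \<le> C\<^sup>2 * (x \<bullet> x)"
proof -
  define w where "w = B *\<^sub>v x"
  have w: "w \<in> carrier_vec n" using B x by (simp add: w_def)
  \<comment> \<open>The factor \<open>1 / C\<close> balances the two squared norms: when the bound is sharp they are equal.\<close>
  have "2 * \<bar>((1 / C) \<cdot>\<^sub>v w) \<bullet> (B *\<^sub>v x)\<bar>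
      \<le> C * (((1 / C) \<cdot>\<^sub>v w) \<bullet> ((1 / C) \<cdot>\<^sub>v w) + x \<bullet> x)"
    using w by (intro schur_test_bilinear[OF B row col x]) auto
  then have "2 * \<bar>(w \<bullet> w) / C\<bar> \<le> C * ((w \<bullet> w) / C\<^sup>2 + x \<bullet> x)"
    using w by (simp add: w_def[symmetric] power2_eq_square)
  moreover have "(w \<bullet> w) / C \<le> \<bar>(w \<bullet> w) / C\<bar>" by (rule abs_ge_self)
  moreover have "C * ((w \<bullet> w) / C\<^sup>2 + x \<bullet> x) = (w \<bullet> w) / C + C * (x \<bullet> x)"
    using C by (simp add: field_simps power2_eq_square)
  ultimately have "(w \<bullet> w) / C \<le> C * (x \<bullet> x)" by linarith
  then show ?thesis using C by (simp add: w_def[symmetric] field_simps power2_eq_square)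
qed

lemma spectral_norm_le:
  assumes "\<And>x. x \<in> carrier_vec (dim_col B) \<Longrightarrow> x \<bullet> x \<le> 1 \<Longrightarrow> (B *\<^sub>v x) \<bullet> (B *\<^sub>v x) \<le> b\<^sup>2"
    and "b \<ge> 0"
  shows "spectral_norm B \<le> b"
  unfolding spectral_norm_def
proof (rule cSUP_least)
  show "{v \<in> carrier_vec (dim_col B). sqrt (v \<bullet> v) \<le> 1} \<noteq> {}"
    by (auto intro!: exI[of _ "0\<^sub>v (dim_col B)"])
next
  fix v assume "v \<in> {v \<in> carrier_vec (dim_col B). sqrt (v \<bullet> v) \<le> 1}"
  then show "sqrt ((B *\<^sub>v v) \<bullet> (B *\<^sub>v v)) \<le> b"
    using assms by (auto intro: real_le_lsqrt)
qed

section \<open>Rank and inverse\<close>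

text \<open>
  A maximal independent set of columns does not contain the zero vector, so all its elements are
  columns with an index in \<open>S\<close>.
\<close>

lemma (in vec_space) rank_le_card_nonzero_cols:
  assumes A: "A \<in> carrier_mat n nc" and "finite S"
    and "\<And>j. j < nc \<Longrightarrow> j \<notin> S \<Longrightarrow> col A j = 0\<^sub>v n"
  shows "rank A \<le> card S"
proof -
  obtain W where W: "maximal W (\<lambda>T. T \<subseteq> set (cols A) \<and> lin_indpt T)"
    using maximal_exists[of "(\<lambda>T. T \<subseteq> set (cols A) \<and> lin_indpt T)" "card (set (cols A))" "{}"]
    by (meson List.finite_set card_mono empty_iff empty_subsetI finite_lin_indpt2 rev_finite_subset)
  then have sub: "W \<subseteq> set (cols A)" and li: "lin_indpt W"
    by (auto simp: maximal_def)
  have car: "W \<subseteq> carrier_vec n" using sub cols_dim A by blast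
  have "0\<^sub>v n \<notin> W"
    using zero_nin_lin_indpt[OF _ li] car class_semiring.one_zeroI by auto
  then have "W \<subseteq> col A ` S"
  proof (intro subsetI)
    fix w assume "w \<in> W"
    with sub A obtain j where "j < nc" "w = col A j" by (auto simp: cols_def)
    with \<open>w \<in> W\<close> \<open>0\<^sub>v n \<notin> W\<close> assms(3) show "w \<in> col A ` S" by (metis imageI)
  qed
  then have "card W \<le> card S"
    using assms(2) by (meson card_image_le card_mono finite_imageI order_trans)
  then show ?thesis using rank_card_indpt[OF A W] by simp
qed

text \<open>
  The finite-dimensional Lax-Milgram lemma.  Coercivity excludes a kernel; for \<open>y = R\<inverse> w\<close> it gives
  \<open>\<mu> \<parallel>y\<parallel>\<^sup>2 \<le> y \<bullet> w\<close>, and Young's inequality with weight \<open>\<mu>\<close> absorbs \<open>y\<close> on the left.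
\<close>

lemma coercive_mat_inverse:
  fixes R :: "real mat"
  assumes R: "R \<in> carrier_mat n n" and \<mu>: "\<mu> > 0"
    and coercive: "\<And>x. x \<in> carrier_vec n \<Longrightarrow> \<mu> * (x \<bullet> x) \<le> x \<bullet> (R *\<^sub>v x)"
  obtains Rinv where "mat_inverse R = Some Rinv" "Rinv \<in> carrier_mat n n"
    "Rinv * R = 1\<^sub>m n"
    "\<And>w. w \<in> carrier_vec n \<Longrightarrow> (Rinv *\<^sub>v w) \<bullet> (Rinv *\<^sub>v w) \<le> (w \<bullet> w) / \<mu>\<^sup>2"
proof -
  have "det R \<noteq> 0"
  proof
    assume "det R = 0"
    then obtain v where v: "v \<in> carrier_vec n" "v \<noteq> 0\<^sub>v n" "R *\<^sub>v v = 0\<^sub>v n"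
      using det_0_iff_vec_prod_zero_field[OF R] by blast
    then have "\<mu> * (v \<bullet> v) \<le> 0" using coercive[OF v(1)] by simp
    then have "v \<bullet> v \<le> 0" using \<mu> by (simp add: mult_le_0_iff)
    with v scalar_prod_nonpos_imp_zero show False by blast
  qed
  then have "mat_inverse R \<noteq> None"
    using mat_inverse(1)[OF R, of "()"] det_non_zero_imp_unit[OF R, of "()"] by blast
  then obtain Rinv where inv: "mat_inverse R = Some Rinv" by blast
  note props = mat_inverse(2)[OF R inv]
  have bound: "(Rinv *\<^sub>v w) \<bullet> (Rinv *\<^sub>v w) \<le> (w \<bullet> w) / \<mu>\<^sup>2" if w: "w \<in> carrier_vec n" for w
  proof -
    define y where "y = Rinv *\<^sub>v w"
    have y: "y \<in> carrier_vec n" using props w by (simp add: y_def mult_mat_vec_carrier[of _ n n])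
    have "R *\<^sub>v y = (R * Rinv) *\<^sub>v w"
      unfolding y_def using R props w by (intro assoc_mult_mat_vec[symmetric]) auto
    then have "R *\<^sub>v y = w" using props w by simp
    then have "\<mu> * (y \<bullet> y) \<le> y \<bullet> w" using coercive[OF y] by simp
    moreover have "2 * (y \<bullet> w) \<le> \<mu> * (y \<bullet> y) + (w \<bullet> w) / \<mu>"
      by (rule scalar_prod_young[OF w y \<mu>])
    ultimately have "\<mu> * (y \<bullet> y) \<le> (w \<bullet> w) / \<mu>" by linarith
    then show ?thesis using \<mu> by (simp add: y_def[symmetric] field_simps power2_eq_square)
  qed
  from props have "Rinv \<in> carrier_mat n n" "Rinv * R = 1\<^sub>m n" by blast+
  then show ?thesis by (rule that[OF inv _ _ bound])
qed

section \<open>Row sums of Toeplitz and circulant matrices\<close>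

lemma toeplitz_mat_carrier [simp]: "toeplitz_mat n t \<in> carrier_mat n n"
  by (simp add: toeplitz_mat_def)

lemma toeplitz_mat_index [simp]:
  "i < n \<Longrightarrow> j < n \<Longrightarrow> toeplitz_mat n t $$ (i, j) = t (int i - int j)"
  by (simp add: toeplitz_mat_def)

lemma toeplitz_row_sum:
  fixes t :: "int \<Rightarrow> real"
  assumes "i < n" and "t 0 = 0" and even: "\<And>k. t (- k) = t k"
  shows "(\<Sum>j = 0..<n. \<bar>t (int i - int j)\<bar>)
    = (\<Sum>k = 1..<Suc i. \<bar>t (int k)\<bar>) + (\<Sum>k = 1..<n - i. \<bar>t (int k)\<bar>)"
proof -
  have "(\<Sum>j = 0..<n. \<bar>t (int i - int j)\<bar>)
    = (\<Sum>j = 0..<i. \<bar>t (int i - int j)\<bar>) + (\<Sum>j = i..<n. \<bar>t (int i - int j)\<bar>)"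
    using assms(1) by (intro sum.atLeastLessThan_concat[symmetric]) auto
  moreover have "(\<Sum>j = 0..<i. \<bar>t (int i - int j)\<bar>) = (\<Sum>k = 1..<Suc i. \<bar>t (int k)\<bar>)"
    by (rule sum.reindex_bij_witness[of _ "\<lambda>k. i - k" "\<lambda>j. i - j"]) (auto simp: of_nat_diff)
  moreover have "(\<Sum>j = i..<n. \<bar>t (int i - int j)\<bar>) = (\<Sum>j = Suc i..<n. \<bar>t (int i - int j)\<bar>)"
    using assms by (simp add: sum.atLeast_Suc_lessThan)
  moreover have "(\<Sum>j = Suc i..<n. \<bar>t (int i - int j)\<bar>) = (\<Sum>k = 1..<n - i. \<bar>t (int k)\<bar>)"
    by (rule sum.reindex_bij_witness[of _ "\<lambda>k. i + k" "\<lambda>j. j - i"])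
      (auto simp: of_nat_diff even[of "int i - int j" for j, simplified, symmetric])
  ultimately show ?thesis by simp
qed

lemma sum_reflect:
  fixes f :: "nat \<Rightarrow> real"
  assumes "m \<le> n"
  shows "(\<Sum>k = l..<m. f (n - k)) = (\<Sum>k = Suc (n - m)..<Suc (n - l). f k)"
  by (rule sum.reindex_bij_witness[of _ "\<lambda>k. n - k" "\<lambda>k. n - k"]) (use assms in auto)

text \<open>
  The entries to the right of the diagonal wrap around: by \<open>r (n - k) = r k\<close> they supply exactly the
  indices \<open>k > i\<close> that are missing on the left.  Bounding the two sides of the diagonal separately
  would lose a factor 2, and with it the diagonal dominance of the circulant approximation.
\<close>

lemma circulant_row_sum:
  fixes r :: "int \<Rightarrow> real"
  assumes "i < n" and "r 0 = 0" and "\<And>k. r (- k) = r k"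
    and circ: "\<And>k. 0 < k \<Longrightarrow> k < n \<Longrightarrow> r (int (n - k)) = r (int k)"
  shows "(\<Sum>j = 0..<n. \<bar>r (int i - int j)\<bar>) = (\<Sum>k = 1..<n. \<bar>r (int k)\<bar>)"
proof -
  have "(\<Sum>k = 1..<n - i. \<bar>r (int k)\<bar>) = (\<Sum>k = 1..<n - i. \<bar>r (int (n - k))\<bar>)"
    using circ by (intro sum.cong) auto
  also have "\<dots> = (\<Sum>k = Suc i..<n. \<bar>r (int k)\<bar>)"
    using assms(1) sum_reflect[of "n - i" n "\<lambda>k. \<bar>r (int k)\<bar>" 1] by simp
  finally have "(\<Sum>j = 0..<n. \<bar>r (int i - int j)\<bar>)
      = (\<Sum>k = 1..<Suc i. \<bar>r (int k)\<bar>) + (\<Sum>k = Suc i..<n. \<bar>r (int k)\<bar>)"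
    using assms(1-3) by (simp only: toeplitz_row_sum)
  also have "\<dots> = (\<Sum>k = 1..<n. \<bar>r (int k)\<bar>)"
    using assms(1) by (intro sum.atLeastLessThan_concat) auto
  finally show ?thesis .
qed

section \<open>Clustering for diagonally dominant symbols\<close>

text \<open>
  The last assumption says that every Toeplitz matrix with symbol \<open>t\<close> is weakly diagonally dominant.
  It is stated with finite sums, from which summability of \<open>t\<close> follows.
\<close>

locale clustering_symbol =
  fixes t :: "int \<Rightarrow> real"
  assumes even: "t (- k) = t k"
    and nonpos: "k \<noteq> 0 \<Longrightarrow> t k \<le> 0"
    and dominant: "2 * (\<Sum>k = 1..<m. \<bar>t (int k)\<bar>) \<le> t 0"
begin

text \<open>
  Every off-diagonal entry is \<open>t k + t (k - n)\<close>, so the absolute off-diagonal row sum is at most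
  \<open>2 * (\<Sum>k = 1..<n. \<bar>t k\<bar>) \<le> t 0\<close>, the diagonal entry.
\<close>

lemma chan_quadratic_form_nonneg:
  assumes x: "x \<in> carrier_vec n"
  shows "0 \<le> x \<bullet> (toeplitz_mat n (chan_coeff n t) *\<^sub>v x)"
proof -
  \<comment> \<open>The off-diagonal part, cut off outside \<open>\<bar>k\<bar> < n\<close> so that it is even on all integers.\<close>
  define r where "r k = (if k = 0 \<or> \<bar>k\<bar> \<ge> int n then 0 else chan_coeff n t k)" for k
  have r: "r (int k) = t (int k) + t (int (n - k))" if "0 < k" "k < n" for k
    using that even[of "int (n - k)"] by (simp add: r_def chan_coeff_def of_nat_diff)
  have r_even: "r (- k) = r k" for k
    using even[of k] even[of "k + int n"] even[of "k - int n"]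
    by (auto simp: r_def chan_coeff_def Let_def algebra_simps)
  have row: "(\<Sum>j = 0..<n. \<bar>r (int i - int j)\<bar>) \<le> t 0" if "i < n" for i
  proof -
    have "(\<Sum>j = 0..<n. \<bar>r (int i - int j)\<bar>) = (\<Sum>k = 1..<n. \<bar>r (int k)\<bar>)"
    proof (rule circulant_row_sum)
      fix k assume "0 < k" "k < n"
      then show "r (int (n - k)) = r (int k)" using r[of k] r[of "n - k"] by simp
    qed (use that r_even in \<open>auto simp: r_def[of 0]\<close>)
    also have "\<dots> \<le> (\<Sum>k = 1..<n. \<bar>t (int k)\<bar> + \<bar>t (int (n - k))\<bar>)"
      using r by (intro sum_mono) auto
    also have "\<dots> = 2 * (\<Sum>k = 1..<n. \<bar>t (int k)\<bar>)"
      using that sum_reflect[of n n "\<lambda>k. \<bar>t (int k)\<bar>" 1] by (simp add: sum.distrib)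
    also have "\<dots> \<le> t 0" by (rule dominant)
    finally show ?thesis .
  qed
  have col: "(\<Sum>i = 0..<n. \<bar>r (int i - int j)\<bar>) \<le> t 0" if "j < n" for j
    using row[OF that] r_even[of "int j - int i" for i] by (simp add: minus_diff_eq)
  have "2 * \<bar>x \<bullet> (toeplitz_mat n r *\<^sub>v x)\<bar> \<le> t 0 * (x \<bullet> x + x \<bullet> x)"
    using row col by (intro schur_test_bilinear[OF toeplitz_mat_carrier _ _ x x]) auto
  moreover have "toeplitz_mat n (chan_coeff n t) = t 0 \<cdot>\<^sub>m 1\<^sub>m n + 1 \<cdot>\<^sub>m toeplitz_mat n r"
    by (rule eq_matI) (auto simp: toeplitz_mat_def r_def chan_coeff_def)
  then have "x \<bullet> (toeplitz_mat n (chan_coeff n t) *\<^sub>v x)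
      = t 0 * (x \<bullet> x) + x \<bullet> (toeplitz_mat n r *\<^sub>v x)"
    using quadratic_form_shift[OF toeplitz_mat_carrier x, of "t 0" 1 r] by simp
  ultimately show ?thesis unfolding distrib_left by linarith
qed

lemma tail_small:
  assumes "\<delta> > 0"
  obtains p where "\<And>m. (\<Sum>k = p..<m. \<bar>t (int k)\<bar>) \<le> \<delta>"
proof -
  have "summable (\<lambda>k. \<bar>t (int (Suc k))\<bar>)"
  proof (rule summableI_nonneg_bounded)
    fix m
    show "(\<Sum>k<m. \<bar>t (int (Suc k))\<bar>) \<le> t 0"
    proof -
      have "(\<Sum>k<m. \<bar>t (int (Suc k))\<bar>) = (\<Sum>k = 1..<Suc m. \<bar>t (int k)\<bar>)"
        using sum.shift_bounds_Suc_ivl[of "\<lambda>k. \<bar>t (int k)\<bar>" 0 m]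
        by (simp only: atLeast0LessThan One_nat_def)
      moreover have "0 \<le> (\<Sum>k = 1..<Suc m. \<bar>t (int k)\<bar>)" by (rule sum_nonneg) auto
      ultimately show ?thesis using dominant[of "Suc m"] by linarith
    qed
  qed auto
  then have "summable (\<lambda>k. \<bar>t (int k)\<bar>)" by (subst (asm) summable_Suc_iff)
  then obtain p where p: "\<And>m n. m \<ge> p \<Longrightarrow> norm (\<Sum>k = m..<n. \<bar>t (int k)\<bar>) < \<delta>"
    using assms unfolding summable_Cauchy by blast
  have "(\<Sum>k = p..<m. \<bar>t (int k)\<bar>) \<le> \<delta>" for m
    using p[of p m] by (simp add: abs_if split: if_splits)
  then show ?thesis using that by blast
qed

text \<open>
  The part of the Toeplitz-minus-circulant symbol that lives on the outermost diagonals, where the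
  argument \<open>n - \<bar>k\<bar>\<close> of \<open>t\<close> is below \<open>p\<close>, and the part where it is at least \<open>p\<close>.  Both vanish for
  \<open>\<bar>k\<bar> \<ge> n\<close>, where no matrix entry reads them.  The subtraction \<open>n - p\<close> is done in the integers,
  which allows \<open>p > n\<close>.
\<close>

definition corner :: "nat \<Rightarrow> nat \<Rightarrow> int \<Rightarrow> real" where
  "corner n p k = (if int n - int p < \<bar>k\<bar> \<and> \<bar>k\<bar> < int n \<and> k \<noteq> 0 then - t (int n - \<bar>k\<bar>) else 0)"

definition band :: "nat \<Rightarrow> nat \<Rightarrow> int \<Rightarrow> real" where
  "band n p k = (if \<bar>k\<bar> \<le> int n - int p \<and> \<bar>k\<bar> < int n \<and> k \<noteq> 0 then - t (int n - \<bar>k\<bar>) else 0)"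

lemma toeplitz_eq_chan_plus:
  "toeplitz_mat n t = toeplitz_mat n (chan_coeff n t)
     + (toeplitz_mat n (corner n p) + toeplitz_mat n (band n p))"
proof (rule eq_matI)
  fix i j
  assume "i < dim_row (toeplitz_mat n (chan_coeff n t)
     + (toeplitz_mat n (corner n p) + toeplitz_mat n (band n p)))"
    and "j < dim_col (toeplitz_mat n (chan_coeff n t)
     + (toeplitz_mat n (corner n p) + toeplitz_mat n (band n p)))"
  then have ij: "i < n" "j < n" by (auto simp: toeplitz_mat_def)
  define k where "k = int i - int j"
  have k: "\<bar>k\<bar> < int n" using ij by (auto simp: k_def)
  have "t k = chan_coeff n t k + (corner n p k + band n p k)"
    using k even[of "int n - k"] even[of "int n + k"]
    by (auto simp: chan_coeff_def corner_def band_def Let_def algebra_simps)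
  then show "toeplitz_mat n t $$ (i, j) = (toeplitz_mat n (chan_coeff n t)
     + (toeplitz_mat n (corner n p) + toeplitz_mat n (band n p))) $$ (i, j)"
    using ij by (simp add: toeplitz_mat_def k_def)
qed (auto simp: toeplitz_mat_def)

text \<open>
  On each side of the diagonal the arguments \<open>n - \<bar>i - j\<bar>\<close> are distinct and at least \<open>p\<close>, so each
  side contributes at most one tail of the series.
\<close>

lemma band_abs_sum:
  assumes p: "\<And>m. (\<Sum>k = p..<m. \<bar>t (int k)\<bar>) \<le> \<delta>" and "i < n"
  shows "(\<Sum>j = 0..<n. \<bar>band n p (int i - int j)\<bar>) \<le> 2 * \<delta>"
proof -
  have half: "(\<Sum>k = 1..<m. \<bar>band n p (int k)\<bar>) \<le> \<delta>" if m: "m \<le> n" for m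
  proof -
    have "(\<Sum>k = 1..<m. \<bar>band n p (int k)\<bar>) \<le> (\<Sum>k = 1..<m. if p \<le> n - k then \<bar>t (int (n - k))\<bar> else 0)"
      using m by (intro sum_mono) (auto simp: band_def of_nat_diff)
    also have "\<dots> = (\<Sum>k = Suc (n - m)..<n. if p \<le> k then \<bar>t (int k)\<bar> else 0)"
    proof (cases n)
      case 0
      then show ?thesis using m by simp
    next
      case (Suc n')
      then show ?thesis
        using sum_reflect[OF m, of "\<lambda>k. if p \<le> k then \<bar>t (int k)\<bar> else 0" 1] by simp
    qed
    also have "\<dots> \<le> (\<Sum>k = 0..<n. if p \<le> k then \<bar>t (int k)\<bar> else 0)"
      by (rule sum_mono2) auto
    also have "\<dots> = (\<Sum>k = p..<n. \<bar>t (int k)\<bar>)"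
      by (rule sum.mono_neutral_cong_right) auto
    also have "\<dots> \<le> \<delta>" by (rule p)
    finally show ?thesis .
  qed
  have "(\<Sum>j = 0..<n. \<bar>band n p (int i - int j)\<bar>)
      = (\<Sum>k = 1..<Suc i. \<bar>band n p (int k)\<bar>) + (\<Sum>k = 1..<n - i. \<bar>band n p (int k)\<bar>)"
    using assms(2) by (intro toeplitz_row_sum) (auto simp: band_def)
  also have "\<dots> \<le> \<delta> + \<delta>" using assms(2) by (intro add_mono half) auto
  finally show ?thesis by simp
qed

lemma band_mult_vec_bound:
  assumes "\<And>m. (\<Sum>k = p..<m. \<bar>t (int k)\<bar>) \<le> \<delta>" "\<delta> > 0" and "x \<in> carrier_vec n"
  shows "(toeplitz_mat n (band n p) *\<^sub>v x) \<bullet> (toeplitz_mat n (band n p) *\<^sub>v x)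
    \<le> (2 * \<delta>)\<^sup>2 * (x \<bullet> x)"
proof (rule schur_test)
  fix j assume "j < n"
  have "band n p (int i - int j) = band n p (int j - int i)" for i
    by (simp add: band_def abs_minus_commute)
  then show "(\<Sum>i = 0..<n. \<bar>toeplitz_mat n (band n p) $$ (i, j)\<bar>) \<le> 2 * \<delta>"
    using band_abs_sum[OF assms(1) \<open>j < n\<close>] \<open>j < n\<close> by simp
qed (use band_abs_sum[OF assms(1)] assms in auto)

lemma corner_zero_cols:
  assumes "i < n" "j < n" "j \<notin> {0..<p} \<union> {n - p..<n}"
  shows "corner n p (int i - int j) = 0"
  using assms by (auto simp: corner_def)

text \<open>
  The cut \<open>p\<close> depends on the lower bound for \<open>\<mu>\<close> and the upper bound for \<open>\<kappa>\<close> only, hence the rank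
  bound is uniform in the order \<open>n\<close>.
\<close>

theorem chan_preconditioner_clustering:
  assumes "c > 0" and "b > 0" and "\<epsilon> > 0"
  obtains p where "\<And>n \<mu> \<kappa>. c \<le> \<mu> \<Longrightarrow> 0 \<le> \<kappa> \<Longrightarrow> \<kappa> \<le> b \<Longrightarrow>
    \<exists>Rinv U V. mat_inverse (\<mu> \<cdot>\<^sub>m 1\<^sub>m n + \<kappa> \<cdot>\<^sub>m toeplitz_mat n (chan_coeff n t)) = Some Rinv \<and>
       U \<in> carrier_mat n n \<and> V \<in> carrier_mat n n \<and>
       Rinv * (\<mu> \<cdot>\<^sub>m 1\<^sub>m n + \<kappa> \<cdot>\<^sub>m toeplitz_mat n t) - 1\<^sub>m n = U + V \<and>
       vec_space.rank n U \<le> 2 * p \<and> spectral_norm V < \<epsilon>"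
proof -
  \<comment> \<open>The remainder has norm at most \<open>\<kappa> * (2 * \<delta>) / \<mu> \<le> b * (2 * \<delta>) / c = \<epsilon> / 2\<close>.\<close>
  define \<delta> where "\<delta> = \<epsilon> * c / (4 * b)"
  have \<delta>: "\<delta> > 0" using assms by (simp add: \<delta>_def)
  obtain p where p: "\<And>m. (\<Sum>k = p..<m. \<bar>t (int k)\<bar>) \<le> \<delta>" using tail_small[OF \<delta>] by blast
  show ?thesis
  proof (rule that[of p])
    fix n :: nat and \<mu> \<kappa> :: real
    assume \<mu>: "c \<le> \<mu>" and \<kappa>: "0 \<le> \<kappa>" "\<kappa> \<le> b"
    define S where "S = toeplitz_mat n (chan_coeff n t)"
    define C where "C = toeplitz_mat n (corner n p)"
    define B where "B = toeplitz_mat n (band n p)"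
    define R where "R = \<mu> \<cdot>\<^sub>m 1\<^sub>m n + \<kappa> \<cdot>\<^sub>m S"
    define A where "A = \<mu> \<cdot>\<^sub>m 1\<^sub>m n + \<kappa> \<cdot>\<^sub>m toeplitz_mat n t"
    have car [simp]: "S \<in> carrier_mat n n" "C \<in> carrier_mat n n" "B \<in> carrier_mat n n"
      by (simp_all add: S_def C_def B_def)
    have R [simp]: "R \<in> carrier_mat n n" by (simp add: R_def)
    have \<mu>0: "\<mu> > 0" using \<mu> assms by linarith
    have coercive: "\<mu> * (x \<bullet> x) \<le> x \<bullet> (R *\<^sub>v x)" if x: "x \<in> carrier_vec n" for x
    proof -
      have "0 \<le> \<kappa> * (x \<bullet> (S *\<^sub>v x))"
        using chan_quadratic_form_nonneg[OF x] \<kappa> by (simp add: S_def)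
      then show ?thesis by (simp add: R_def quadratic_form_shift[OF car(1) x])
    qed
    obtain Rinv where inv: "mat_inverse R = Some Rinv" and Rinv [simp]: "Rinv \<in> carrier_mat n n"
      and RR: "Rinv * R = 1\<^sub>m n"
      and bound: "\<And>w. w \<in> carrier_vec n \<Longrightarrow> (Rinv *\<^sub>v w) \<bullet> (Rinv *\<^sub>v w) \<le> (w \<bullet> w) / \<mu>\<^sup>2"
      using coercive_mat_inverse[OF R \<mu>0 coercive] by blast
    define U where "U = Rinv * (\<kappa> \<cdot>\<^sub>m C)"
    define V where "V = Rinv * (\<kappa> \<cdot>\<^sub>m B)"
    have U: "U \<in> carrier_mat n n" and V: "V \<in> carrier_mat n n"
      by (simp_all add: U_def V_def mult_carrier_mat[of _ n n])
    have "A = R + (\<kappa> \<cdot>\<^sub>m C + \<kappa> \<cdot>\<^sub>m B)"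
      unfolding A_def R_def toeplitz_eq_chan_plus[of n p] S_def C_def B_def
      by (rule eq_matI) (auto simp: toeplitz_mat_def algebra_simps)
    then have "Rinv * A = 1\<^sub>m n + (U + V)"
      by (simp add: U_def V_def RR[symmetric] mult_add_distrib_mat[of _ n n _ n])
    then have sum: "Rinv * A - 1\<^sub>m n = U + V"
      using U V by (intro eq_matI) auto
    have "vec_space.rank n U \<le> card ({0..<p} \<union> {n - p..<n})"
    proof (rule vec_space.rank_le_card_nonzero_cols[OF U])
      fix j assume j: "j < n" "j \<notin> {0..<p} \<union> {n - p..<n}"
      have "col (\<kappa> \<cdot>\<^sub>m C) j = 0\<^sub>v n"
        using j corner_zero_cols[OF _ j]
        by (intro eq_vecI) (auto simp: C_def toeplitz_mat_def)
      moreover have "Rinv *\<^sub>v 0\<^sub>v n = 0\<^sub>v n" by (rule eq_vecI) (use carrier_matD[OF Rinv] in auto)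
      ultimately show "col U j = 0\<^sub>v n"
        using j by (simp add: U_def col_mult2[of _ n n _ n])
    qed auto
    also have "\<dots> \<le> p + p"
      by (rule order_trans[OF card_Un_le]) auto
    finally have rank: "vec_space.rank n U \<le> 2 * p" by simp
    have "spectral_norm V \<le> b * (2 * \<delta>) / c"
    proof (rule spectral_norm_le)
      fix x :: "real Matrix.vec" assume "x \<in> carrier_vec (dim_col V)" and x1: "x \<bullet> x \<le> 1"
      then have x: "x \<in> carrier_vec n" using V by simp
      define w where "w = \<kappa> \<cdot>\<^sub>v (B *\<^sub>v x)"
      have w: "w \<in> carrier_vec n" using x by (simp add: w_def mult_mat_vec_carrier[of _ n n])
      have "V *\<^sub>v x = Rinv *\<^sub>v w"
        using x by (simp add: V_def w_def assoc_mult_mat_vec[of _ n n _ n] smult_mat_mult_vec[of _ n n])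
      then have "(V *\<^sub>v x) \<bullet> (V *\<^sub>v x) \<le> (w \<bullet> w) / \<mu>\<^sup>2" using bound[OF w] by simp
      also have "w \<bullet> w = \<kappa>\<^sup>2 * ((B *\<^sub>v x) \<bullet> (B *\<^sub>v x))"
        using x by (simp add: w_def power2_eq_square mult_mat_vec_carrier[of _ n n] smult_scalar_prod_distrib[of _ n] scalar_prod_smult_distrib[of _ n])
      also have "\<kappa>\<^sup>2 * ((B *\<^sub>v x) \<bullet> (B *\<^sub>v x)) / \<mu>\<^sup>2 \<le> \<kappa>\<^sup>2 * ((2 * \<delta>)\<^sup>2 * 1) / \<mu>\<^sup>2"
      proof (intro divide_right_mono mult_left_mono)
        have "(B *\<^sub>v x) \<bullet> (B *\<^sub>v x) \<le> (2 * \<delta>)\<^sup>2 * (x \<bullet> x)"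
          unfolding B_def by (rule band_mult_vec_bound[OF p \<delta> x])
        also have "\<dots> \<le> (2 * \<delta>)\<^sup>2 * 1" using x1 by (intro mult_left_mono) auto
        finally show "(B *\<^sub>v x) \<bullet> (B *\<^sub>v x) \<le> (2 * \<delta>)\<^sup>2 * 1" .
      qed auto
      also have "\<dots> = (\<kappa> * (2 * \<delta>) / \<mu>)\<^sup>2"
        by (simp add: power_mult_distrib power_divide)
      also have "\<dots> \<le> (b * (2 * \<delta>) / c)\<^sup>2"
        using \<kappa> \<mu> \<delta> assms by (intro power_mono frac_le mult_right_mono) auto
      finally show "(V *\<^sub>v x) \<bullet> (V *\<^sub>v x) \<le> (b * (2 * \<delta>) / c)\<^sup>2" .
    qed (use assms \<delta> in auto)
    also have "\<dots> < \<epsilon>" using assms by (simp add: \<delta>_def)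
    finally have norm: "spectral_norm V < \<epsilon>" .
    show "\<exists>Rinv U V.
       mat_inverse (\<mu> \<cdot>\<^sub>m 1\<^sub>m n + \<kappa> \<cdot>\<^sub>m toeplitz_mat n (chan_coeff n t)) = Some Rinv \<and>
       U \<in> carrier_mat n n \<and> V \<in> carrier_mat n n \<and>
       Rinv * (\<mu> \<cdot>\<^sub>m 1\<^sub>m n + \<kappa> \<cdot>\<^sub>m toeplitz_mat n t) - 1\<^sub>m n = U + V \<and>
       vec_space.rank n U \<le> 2 * p \<and> spectral_norm V < \<epsilon>"
      by (intro exI[of _ Rinv] exI[of _ U] exI[of _ V] conjI
          inv[unfolded R_def S_def] U V sum[unfolded A_def] rank norm)
  qed
qed

end

section \<open>The fractional centred difference coefficients\<close>

lemma g_hat_even: "g_hat \<beta> (- k) = g_hat \<beta> k"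
  by (simp add: g_hat_def power_int_minus_left power_int_minus field_simps)

text \<open>
  The functional equation \<open>rGamma z = z * rGamma (z + 1)\<close> at \<open>z = \<beta> / 2 - k\<close> and
  \<open>z = \<beta> / 2 + k + 1\<close>.  The denominator is multiplied out, and the equation for \<open>rGamma\<close> holds at
  the poles of \<open>Gamma\<close> too, so the case \<open>\<beta> = 2\<close>, where the coefficients vanish for \<open>k \<ge> 2\<close>, is
  included.
\<close>

lemma g_hat_recurrence:
  "(real k + 1 + \<beta> / 2) * g_hat \<beta> (int (Suc k)) = (real k - \<beta> / 2) * g_hat \<beta> (int k)"
proof -
  define x where "x = \<beta> / 2 - real k"
  define y where "y = \<beta> / 2 + real k + 1"
  have x: "rGamma x = x * rGamma (x + 1)" and y: "rGamma y = y * rGamma (y + 1)"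
    by (simp_all add: rGamma_plus1)
  have g0: "g_hat \<beta> (int k) = (-1) ^ k * Gamma (\<beta> + 1) * rGamma (x + 1) * rGamma y"
    by (simp add: g_hat_def x_def y_def)
  have g1: "g_hat \<beta> (int (Suc k)) = - ((-1) ^ k * Gamma (\<beta> + 1) * rGamma x * rGamma (y + 1))"
    unfolding g_hat_def x_def y_def power_int_of_nat by (simp add: algebra_simps)
  have "(real k + 1 + \<beta> / 2) = y" "(real k - \<beta> / 2) = - x" by (simp_all add: x_def y_def)
  then show ?thesis by (simp only: g0 g1 x y) (simp add: algebra_simps)
qed

lemma g_hat_0_nonneg: "\<beta> > 0 \<Longrightarrow> g_hat \<beta> 0 \<ge> 0"
  by (simp add: g_hat_def Gamma_real_pos rGamma_inverse_Gamma less_imp_le)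

lemma g_hat_Suc_nonpos:
  assumes "0 < \<beta>" "\<beta> \<le> 2"
  shows "g_hat \<beta> (int (Suc k)) \<le> 0"
proof (induction k)
  case 0
  have "(1 + \<beta> / 2) * g_hat \<beta> (int (Suc 0)) = (- \<beta> / 2) * g_hat \<beta> 0"
    using g_hat_recurrence[of 0 \<beta>] by simp
  also have "\<dots> \<le> 0" using g_hat_0_nonneg assms by (intro mult_nonpos_nonneg) auto
  finally show ?case using assms by (simp add: mult_le_0_iff)
next
  case (Suc k)
  have "(real (Suc k) + 1 + \<beta> / 2) * g_hat \<beta> (int (Suc (Suc k)))
      = (real (Suc k) - \<beta> / 2) * g_hat \<beta> (int (Suc k))" by (rule g_hat_recurrence)
  also have "\<dots> \<le> 0" using Suc assms by (intro mult_nonneg_nonpos) auto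
  finally have "(real (Suc k) + 1 + \<beta> / 2) * g_hat \<beta> (int (Suc (Suc k))) \<le> 0" .
  moreover have "real (Suc k) + 1 + \<beta> / 2 > 0" using assms by simp
  ultimately show ?case by (meson linorder_not_less mult_le_0_iff)
qed

text \<open>
  With \<open>h k = (k + \<beta> / 2) * g_hat \<beta> k\<close> the recurrence reads \<open>h (k + 1) = h k - \<beta> * g_hat \<beta> k\<close>, so the
  sum telescopes; its lower boundary term \<open>2 * h 1 = - \<beta> * g_hat \<beta> 0\<close> cancels the central
  coefficient.  For \<open>0 < \<beta> \<le> 2\<close> the right-hand side is nonnegative,
  as \<open>g_hat \<beta> (m + 1) \<le> 0\<close>.
\<close>

lemma g_hat_partial_sum:
  "\<beta> * (g_hat \<beta> 0 + 2 * (\<Sum>k = 1..<Suc m. g_hat \<beta> (int k)))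
    = - 2 * (real m + 1 + \<beta> / 2) * g_hat \<beta> (int (Suc m))"
proof (induction m)
  case 0
  then show ?case using g_hat_recurrence[of 0 \<beta>] by (simp add: algebra_simps)
next
  case (Suc m)
  then show ?case using g_hat_recurrence[of "Suc m" \<beta>] by (simp add: algebra_simps)
qed

lemma clustering_symbol_g_hat:
  assumes "0 < \<beta>" "\<beta> \<le> 2"
  shows "clustering_symbol (g_hat \<beta>)"
proof
  show "g_hat \<beta> (- k) = g_hat \<beta> k" for k by (rule g_hat_even)
  show nonpos: "g_hat \<beta> k \<le> 0" if "k \<noteq> 0" for k
  proof -
    from that have "k = int (Suc (nat \<bar>k\<bar> - 1)) \<or> k = - int (Suc (nat \<bar>k\<bar> - 1))" by arith
    then obtain j where "k = int (Suc j) \<or> k = - int (Suc j)" by blast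
    then show ?thesis using g_hat_Suc_nonpos[OF assms, of j] g_hat_even[of \<beta> "int (Suc j)"] by auto
  qed
  show "2 * (\<Sum>k = 1..<m. \<bar>g_hat \<beta> (int k)\<bar>) \<le> g_hat \<beta> 0" for m
  proof (cases m)
    case 0
    then show ?thesis using g_hat_0_nonneg assms by simp
  next
    case (Suc j)
    have abs: "(\<Sum>k = 1..<m. \<bar>g_hat \<beta> (int k)\<bar>) = - (\<Sum>k = 1..<m. g_hat \<beta> (int k))"
      unfolding sum_negf[symmetric] by (intro sum.cong) (use nonpos in \<open>auto simp: abs_of_nonpos\<close>)
    have "0 \<le> (- 2 * (real j + 1 + \<beta> / 2)) * g_hat \<beta> (int (Suc j))"
      using assms g_hat_Suc_nonpos[OF assms] by (intro mult_nonpos_nonpos) auto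
    then have "0 \<le> \<beta> * (g_hat \<beta> 0 + 2 * (\<Sum>k = 1..<m. g_hat \<beta> (int k)))"
      unfolding Suc g_hat_partial_sum .
    then have "0 \<le> g_hat \<beta> 0 + 2 * (\<Sum>k = 1..<m. g_hat \<beta> (int k))"
      using assms by (simp add: zero_le_mult_iff)
    then show ?thesis unfolding abs by simp
  qed
qed

section \<open>The preconditioned matrices\<close>

text \<open>
  All terms of the quadrature sum are nonnegative, and the one for \<open>l = 0\<close> has \<open>\<gamma> = 0\<close>, weight
  \<open>1 / 2\<close> and \<open>\<tau> powr 0 = 1\<close>.
\<close>

lemma mu0_ge:
  assumes "T > 0" "J \<ge> 1" "N \<ge> 1" and nonneg: "\<forall>\<alpha>\<in>{1..2}. \<omega> \<alpha> \<ge> 0"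
  shows "mu0 T J \<omega> N \<ge> \<omega> 1 / (4 * real J)"
proof -
  define f where "f l = (if l = 0 \<or> l = 2 * J then 1 / 2 else 1) * \<omega> (1 + real l * (1 / (2 * real J)))
    * (T / real N) powr (- (1 + real l * (1 / (2 * real J)) - 1)) * lambda0 (1 + real l * (1 / (2 * real J)) - 1)" for l
  have mu: "mu0 T J \<omega> N = 1 / (2 * real J) * (\<Sum>l = 0..2 * J. f l)"
    by (simp add: mu0_def Let_def f_def)
  have "f 0 \<le> (\<Sum>l = 0..2 * J. f l)"
  proof (rule member_le_sum)
    fix l assume "l \<in> {0..2 * J} - {0}"
    then have "real l * (1 / (2 * real J)) \<le> 1" using assms by (simp add: field_simps)
    then have "\<omega> (1 + real l * (1 / (2 * real J))) \<ge> 0" using nonneg by (simp add: field_simps)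
    then show "f l \<ge> 0" unfolding f_def lambda0_def by (intro mult_nonneg_nonneg) auto
  qed auto
  moreover have "f 0 = \<omega> 1 / 2" using assms by (simp add: f_def lambda0_def)
  ultimately have "1 / (2 * real J) * (\<omega> 1 / 2) \<le> mu0 T J \<omega> N"
    unfolding mu by (intro mult_left_mono) auto
  then show ?thesis by simp
qed

theorem theorem5p1:
  fixes K L T \<beta> :: real and J :: nat and \<omega> :: "real \<Rightarrow> real" and N :: "nat \<Rightarrow> nat"
  assumes "K > 0" and "L > 0" and "T > 0" and "J \<ge> 1"
    and "\<forall>\<alpha>\<in>{1..2}. \<omega> \<alpha> \<ge> 0 \<and> \<omega> \<alpha> \<noteq> 0"
    and "\<omega> integrable_on {1..2}" and "0 < integral {1..2} \<omega>"
    and "1 < \<beta>" and "\<beta> \<le> 2"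
    and "\<forall>M\<ge>2. N M \<ge> 1"
    and "\<exists>\<nu>::real. \<forall>M\<ge>2. nu L T \<beta> M (N M) \<le> \<nu>"
  shows "\<forall>\<epsilon>::real. \<epsilon> > 0 \<longrightarrow> (\<exists>Mstar Nstar :: nat. Mstar > 0 \<and> Nstar > 0 \<and>
    (\<forall>M > Mstar. \<exists>Rinv U V.
       mat_inverse (R_mat K L T J \<omega> \<beta> M (N M)) = Some Rinv \<and>
       U \<in> carrier_mat (M - 1) (M - 1) \<and> V \<in> carrier_mat (M - 1) (M - 1) \<and>
       Rinv * A_mat K L T J \<omega> \<beta> M (N M) - 1\<^sub>m (M - 1) = U + V \<and>
       vec_space.rank (M - 1) U \<le> Nstar \<and>
       spectral_norm V < \<epsilon>))"
proof (intro allI impI)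
  fix \<epsilon> :: real assume \<epsilon>: "\<epsilon> > 0"
  interpret clustering_symbol "g_hat \<beta>"
    using assms(8,9) by (intro clustering_symbol_g_hat) auto
  obtain \<nu> where \<nu>: "\<And>M. M \<ge> 2 \<Longrightarrow> nu L T \<beta> M (N M) \<le> \<nu>" using assms(11) by blast
  define c where "c = \<omega> 1 / (4 * real J)"
  have c: "c > 0" using assms(4,5) by (auto simp: c_def less_le)
  \<comment> \<open>The maximum with 1 gives a positive bound for \<open>\<kappa>\<close> without a case distinction on \<open>\<nu>\<close>.\<close>
  have b: "K * max \<nu> 1 > 0" using assms(1) by auto
  obtain p where p: "\<And>n \<mu> \<kappa>. c \<le> \<mu> \<Longrightarrow> 0 \<le> \<kappa> \<Longrightarrow> \<kappa> \<le> K * max \<nu> 1 \<Longrightarrow>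
    \<exists>Rinv U V. mat_inverse (\<mu> \<cdot>\<^sub>m 1\<^sub>m n + \<kappa> \<cdot>\<^sub>m toeplitz_mat n (chan_coeff n (g_hat \<beta>))) = Some Rinv \<and>
       U \<in> carrier_mat n n \<and> V \<in> carrier_mat n n \<and>
       Rinv * (\<mu> \<cdot>\<^sub>m 1\<^sub>m n + \<kappa> \<cdot>\<^sub>m toeplitz_mat n (g_hat \<beta>)) - 1\<^sub>m n = U + V \<and>
       vec_space.rank n U \<le> 2 * p \<and> spectral_norm V < \<epsilon>"
    using chan_preconditioner_clustering[OF c b \<epsilon>] by blast
  have "\<exists>Rinv U V.
       mat_inverse (R_mat K L T J \<omega> \<beta> M (N M)) = Some Rinv \<and>
       U \<in> carrier_mat (M - 1) (M - 1) \<and> V \<in> carrier_mat (M - 1) (M - 1) \<and>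
       Rinv * A_mat K L T J \<omega> \<beta> M (N M) - 1\<^sub>m (M - 1) = U + V \<and>
       vec_space.rank (M - 1) U \<le> 2 * p + 1 \<and> spectral_norm V < \<epsilon>" if M: "M > 1" for M
  proof -
    have "c \<le> mu0 T J \<omega> (N M)"
      unfolding c_def using assms M by (intro mu0_ge) auto
    moreover have "0 \<le> K * nu L T \<beta> M (N M)" using assms(1,3) by (simp add: nu_def)
    moreover have "K * nu L T \<beta> M (N M) \<le> K * max \<nu> 1"
      using assms(1) \<nu>[of M] M by (intro mult_left_mono) auto
    ultimately show ?thesis
      unfolding R_mat_def A_mat_def G_mat_def rG_mat_def
      using p[of "mu0 T J \<omega> (N M)" "K * nu L T \<beta> M (N M)" "M - 1"] by (meson trans_le_add1)
  qed
  then show "\<exists>Mstar Nstar :: nat. Mstar > 0 \<and> Nstar > 0 \<and>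
    (\<forall>M > Mstar. \<exists>Rinv U V.
       mat_inverse (R_mat K L T J \<omega> \<beta> M (N M)) = Some Rinv \<and>
       U \<in> carrier_mat (M - 1) (M - 1) \<and> V \<in> carrier_mat (M - 1) (M - 1) \<and>
       Rinv * A_mat K L T J \<omega> \<beta> M (N M) - 1\<^sub>m (M - 1) = U + V \<and>
       vec_space.rank (M - 1) U \<le> Nstar \<and>
       spectral_norm V < \<epsilon>)"
    by (intro exI[of _ 1] exI[of _ "2 * p + 1"]) auto
qed

end
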